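(* Let $k_1,k_2\ge 1$, let $A\in\mathbb{R}^{k_1\times k_2}$, let $\eta_1>0$ be an arbitrary fixed step-size, let $x_1^0\in\mathbb{R}^{k_1}$, and let $(x_2^t)_{t\ge 0}$ be an arbitrary sequence in $\mathbb{R}^{k_2}$ (the opponent's strategies, chosen in any manner whatsoever). Let agent 1's strategies be given by alternating gradient descent, i.e. $x_1^{t+1}=x_1^t+\eta_1Ax_2^t$ for all $t\ge 0$. Then agent 1 obtains bounded regret with respect to any fixed strategy: for every $x_1\in\mathbb{R}^{k_1}$ there is a constant $C\in\mathbb{R}$, not depending on $T$, such that for all integers $T\ge 0$, $$\Big\langle 2x_1,\sum_{t=0}^T Ax_2^t\Big\rangle-\sum_{t=0}^T\big\langle x_1^{t+1}+x_1^t,\,Ax_2^t\big\rangle\le C .$$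
   Context: The game: agent $i\in\{1,2\}$ chooses a strategy $x_i\in\mathbb{R}^{k_i}$; agent 1 receives utility $\langle x_1,Ax_2\rangle$. Agents update alternately (first agent 1, then agent 2, and so on), so agent 1 faces each $x_2^t$ twice: once while playing $x_1^t$ and once while playing $x_1^{t+1}$. Her cumulative utility is therefore $\sum_{t=0}^T\langle x_1^{t+1}+x_1^t,Ax_2^t\rangle$, and her regret after $T$ with respect to a fixed strategy $x_1$ is $\langle 2x_1,\sum_{t=0}^TAx_2^t\rangle-\sum_{t=0}^T\langle x_1^{t+1}+x_1^t,Ax_2^t\rangle$. "Bounded regret" means that the regret is bounded above uniformly in $T$. Here $\langle\cdot,\cdot\rangle$ is the Euclidean inner product. *)

theory Defs
  imports "HOL-Analysis.Analysis"
begin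

text \<open>
  Agent 1 has strategy space \<open>real ^ 'k1\<close>, agent 2 has \<open>real ^ 'k2\<close>; the payoff matrix
  has \<open>CARD('k1)\<close> rows and \<open>CARD('k2)\<close> columns. In the definitions below, \<open>x1\<close> and \<open>x2\<close>
  are the sequences of play, indexed by time.
\<close>

definition utility1 :: "real ^ 'k2 ^ 'k1 \<Rightarrow> real ^ 'k1 \<Rightarrow> real ^ 'k2 \<Rightarrow> real" where
  "utility1 A u v = u \<bullet> (A *v v)"

text \<open>
  Under alternating play agent 1 faces \<open>x2 t\<close> twice, first with \<open>x1 t\<close> and then with
  \<open>x1 (Suc t)\<close>.
\<close>

definition cumulative_utility1 ::
    "real ^ 'k2 ^ 'k1 \<Rightarrow> (nat \<Rightarrow> real ^ 'k1) \<Rightarrow> (nat \<Rightarrow> real ^ 'k2) \<Rightarrow> nat \<Rightarrow> real" where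
  "cumulative_utility1 A x1 x2 T = (\<Sum>t=0..T. utility1 A (x1 (Suc t) + x1 t) (x2 t))"

definition regret1 ::
    "real ^ 'k2 ^ 'k1 \<Rightarrow> (nat \<Rightarrow> real ^ 'k1) \<Rightarrow> (nat \<Rightarrow> real ^ 'k2) \<Rightarrow> real ^ 'k1 \<Rightarrow> nat \<Rightarrow> real" where
  "regret1 A x1 x2 u T =
     (2 *\<^sub>R u) \<bullet> (\<Sum>t=0..T. A *v x2 t) - cumulative_utility1 A x1 x2 T"

text \<open>
  Only agent 1's update rule is prescribed; the opponent's sequence is unconstrained.
\<close>

definition alternating_gradient_descent1 ::
    "real ^ 'k2 ^ 'k1 \<Rightarrow> real \<Rightarrow> (nat \<Rightarrow> real ^ 'k1) \<Rightarrow> (nat \<Rightarrow> real ^ 'k2) \<Rightarrow> bool" where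
  "alternating_gradient_descent1 A \<eta> x1 x2 \<longleftrightarrow>
     (\<forall>t. x1 (Suc t) = x1 t + \<eta> *\<^sub>R (A *v x2 t))"

end

theory Submission
  imports Defs
begin

text \<open>
  The scaled increments \<open>\<eta> *\<^sub>R (A *v x2 t) = x1 (Suc t) - x1 t\<close> make each regret summand a
  difference of squared distances to \<open>u\<close>, because \<open>2u \<bullet> (y - x) - (y + x) \<bullet> (y - x) =
  (norm (x - u))\<^sup>2 - (norm (y - u))\<^sup>2\<close>. The regret thus telescopes, and the subtracted last
  term is nonnegative.
\<close>

lemma alternating_regret_telescope:
  assumes "alternating_gradient_descent1 A \<eta> x1 x2"
  shows "\<eta> * regret1 A x1 x2 u T = (norm (x1 0 - u))\<^sup>2 - (norm (x1 (Suc T) - u))\<^sup>2"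
proof -
  have step: "\<eta> * ((2 *\<^sub>R u) \<bullet> (A *v x2 t) - (x1 (Suc t) + x1 t) \<bullet> (A *v x2 t))
      = (norm (x1 t - u))\<^sup>2 - (norm (x1 (Suc t) - u))\<^sup>2" for t
  proof -
    have "\<eta> *\<^sub>R (A *v x2 t) = x1 (Suc t) - x1 t"
      using assms by (simp add: alternating_gradient_descent1_def)
    \<comment> \<open>The factor \<open>\<eta>\<close> moves into the second argument of the inner
      product, turning \<open>A *v x2 t\<close> into the increment of \<open>x1\<close>.\<close>
    then have "\<eta> * ((2 *\<^sub>R u) \<bullet> (A *v x2 t) - (x1 (Suc t) + x1 t) \<bullet> (A *v x2 t))
        = (2 *\<^sub>R u - (x1 (Suc t) + x1 t)) \<bullet> (x1 (Suc t) - x1 t)"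
      by (metis inner_diff_left inner_scaleR_right)
    also have "\<dots> = (norm (x1 t - u))\<^sup>2 - (norm (x1 (Suc t) - u))\<^sup>2"
      by (simp add: power2_norm_eq_inner inner_diff inner_add inner_commute algebra_simps)
    finally show ?thesis .
  qed
  have "\<eta> * regret1 A x1 x2 u T
      = (\<Sum>t=0..T. \<eta> * ((2 *\<^sub>R u) \<bullet> (A *v x2 t) - (x1 (Suc t) + x1 t) \<bullet> (A *v x2 t)))"
    by (simp only: regret1_def cumulative_utility1_def utility1_def inner_sum_right
        sum_subtractf[symmetric] sum_distrib_left)
  also have "\<dots> = (\<Sum>t=0..T. (norm (x1 t - u))\<^sup>2 - (norm (x1 (Suc t) - u))\<^sup>2)"
    by (simp only: step)
  \<comment> \<open>The sum includes \<open>t = T\<close>, whose update already produces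
    \<open>x1 (Suc T)\<close>.\<close>
  also have "\<dots> = (norm (x1 0 - u))\<^sup>2 - (norm (x1 (Suc T) - u))\<^sup>2"
    by (induction T) simp_all
  finally show ?thesis .
qed

theorem theorem2:
  fixes A :: "real ^ 'k2 ^ 'k1"
    and \<eta>1 :: real
    and x1 :: "nat \<Rightarrow> real ^ 'k1"
    and x2 :: "nat \<Rightarrow> real ^ 'k2"
  assumes "\<eta>1 > 0"
    and "alternating_gradient_descent1 A \<eta>1 x1 x2"
  shows "\<forall>u :: real ^ 'k1. \<exists>C :: real. \<forall>T :: nat. regret1 A x1 x2 u T \<le> C"
\<comment> \<open>The witness for \<open>C\<close> stays schematic until the final
  \<open>show\<close>. Introduced before \<open>T\<close>, it may depend on \<open>u\<close> but not
  on \<open>T\<close>.\<close>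
proof (intro allI exI)
  fix u T
  have "\<eta>1 * regret1 A x1 x2 u T \<le> (norm (x1 0 - u))\<^sup>2"
    by (simp add: alternating_regret_telescope[OF assms(2)])
  then show "regret1 A x1 x2 u T \<le> (norm (x1 0 - u))\<^sup>2 / \<eta>1"
    using assms(1) by (simp add: pos_le_divide_eq mult.commute)
qed

end
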